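(* Let $L$ be an irreducible almost lower-triangular transition matrix on $\mathbb N$. Then $L$ admits a time-reversal transition matrix $U$ if and only if it possesses a positive invariant measure $\eta$, in which case $U_{b,a}=\eta_aL_{a,b}/\eta_b$ for all $a,b\in\mathbb{N}$, and $U$ and $L$ are time-reversal of each other. As a consequence, for each such $L$, there is a bijection between the set of classes (up to a positive factor) of invariant measures of $L$ and the set of time-reversal transition matrices $U$ of $L$.
   Context: $\mathbb N=\{0,1,2,\dots\}$. A transition matrix $L=[L_{i,j}]_{i,j\ge0}$ on $\mathbb N$ (non-negative entries, rows summing to $1$) is almost lower-triangular if $L_{i,j}>0\Rightarrow j\le i+1$. Invariant measures are non-negative measures $\eta$ on $\mathbb N$ with total mass in $(0,+\infty]$ such that $\sum_a\eta_aL_{a,b}=\eta_b$ for all $b$. A transition matrix $U$ is a time-reversal of $L$ if there is a positive measure $\eta$ on $\mathbb N$ such that $\eta_aL_{a,b}=\eta_bU_{b,a}$ for all $a,b\in\mathbb N$ (such a $U$ is then almost upper-triangular, i.e. $U_{i,j}>0\Rightarrow j\ge i-1$). Unless otherwise stated, all Markov chains on $\mathbb N$ are irreducible. *)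

theory Defs
  imports Complex_Main "HOL-Library.Extended_Nonnegative_Real"
begin

type_synonym nat_matrix = "nat \<Rightarrow> nat \<Rightarrow> real"

definition transition_matrix :: "nat_matrix \<Rightarrow> bool" where
  "transition_matrix L \<longleftrightarrow> (\<forall>i j. 0 \<le> L i j) \<and> (\<forall>i. (\<lambda>j. L i j) sums 1)"

text \<open>Entries of the matrix powers. The series converges whenever the matrix is a
  transition matrix, which is the only case in which it is used.\<close>

primrec matrix_power :: "nat_matrix \<Rightarrow> nat \<Rightarrow> nat_matrix" where
  "matrix_power L 0 = (\<lambda>i j. if i = j then 1 else 0)"
| "matrix_power L (Suc n) = (\<lambda>i j. \<Sum>k. L i k * matrix_power L n k j)"

definition irreducible_matrix :: "nat_matrix \<Rightarrow> bool" where
  "irreducible_matrix L \<longleftrightarrow> (\<forall>i j. \<exists>n. 0 < matrix_power L n i j)"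

definition almost_lower_triangular :: "nat_matrix \<Rightarrow> bool" where
  "almost_lower_triangular L \<longleftrightarrow> (\<forall>i j. 0 < L i j \<longrightarrow> j \<le> i + 1)"

text \<open>A measure on the natural numbers is given by the masses of its points. These are
  finite (hence real-valued), whereas the total mass may be infinite and is computed in
  the extended non-negative reals.\<close>

definition positive_measure :: "(nat \<Rightarrow> real) \<Rightarrow> bool" where
  "positive_measure \<eta> \<longleftrightarrow> (\<forall>a. 0 < \<eta> a)"

definition invariant_measure :: "nat_matrix \<Rightarrow> (nat \<Rightarrow> real) \<Rightarrow> bool" where
  "invariant_measure L \<eta> \<longleftrightarrow>
     (\<forall>a. 0 \<le> \<eta> a) \<and> 0 < (\<Sum>a. ennreal (\<eta> a)) \<and>
     (\<forall>b. (\<lambda>a. \<eta> a * L a b) sums \<eta> b)"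

text \<open>\<open>time_reversal L U\<close>: the matrix \<open>U\<close> is a time-reversal of \<open>L\<close>.\<close>

definition time_reversal :: "nat_matrix \<Rightarrow> nat_matrix \<Rightarrow> bool" where
  "time_reversal L U \<longleftrightarrow> transition_matrix U \<and>
     (\<exists>\<eta>. positive_measure \<eta> \<and> (\<forall>a b. \<eta> a * L a b = \<eta> b * U b a))"

definition proportional_rel :: "nat_matrix \<Rightarrow> ((nat \<Rightarrow> real) \<times> (nat \<Rightarrow> real)) set" where
  "proportional_rel L = {(\<eta>, \<eta>'). invariant_measure L \<eta> \<and> invariant_measure L \<eta>' \<and>
     (\<exists>c>0. \<forall>a. \<eta>' a = c * \<eta> a)}"

definition invariant_classes :: "nat_matrix \<Rightarrow> (nat \<Rightarrow> real) set set" where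
  "invariant_classes L = {\<eta>. invariant_measure L \<eta>} // proportional_rel L"

end

theory Submission
  imports Defs
begin

text \<open>
  Fix a positive measure \<open>\<eta>\<close>. The balance equations \<open>\<eta> a * L a b = \<eta> b * U b a\<close> leave only one
  candidate for \<open>U\<close>, namely \<open>U b a = \<eta> a * L a b / \<eta> b\<close>, and the row of \<open>U\<close> at \<open>b\<close> sums to \<open>1\<close>
  exactly when \<open>\<Sum>a. \<eta> a * L a b = \<eta> b\<close>. So the positive measures that reverse \<open>L\<close> into a
  transition matrix are its positive invariant measures (lemma \<open>time_reversal_iff\<close>), and the same
  \<open>\<eta>\<close> reverses \<open>U\<close> back into \<open>L\<close>, because the balance equations are symmetric in the two matrices.

  Irreducibility enters twice, each time by propagation along the transitions of \<open>L\<close>, which connect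
  any two states. The support of an invariant measure is closed under transitions, hence is
  everything: each invariant measure is positive (\<open>invariant_measure_positive\<close>). And two
  invariant measures with the same reversal have a quotient that does not change along a
  transition, hence is constant (\<open>proportional_if_same_reversal\<close>). Thus proportionality
  is precisely the kernel of the map that sends an invariant measure to its reversal, and this map
  descends to a bijection from the classes onto its image, which is the set of time-reversals.
\<close>

section \<open>Propagation along transitions\<close>

text \<open>
  A series whose terms all vanish has sum zero, so a non-zero entry of a matrix power yields a path
  of non-zero transitions.
\<close>

lemma matrix_power_nonzero_imp_path:
  "matrix_power L n i j \<noteq> 0 \<Longrightarrow> (\<lambda>a b. L a b \<noteq> 0)\<^sup>*\<^sup>* i j"
proof (induction n arbitrary: i)
  case 0
  then show ?case by (auto split: if_splits)
next
  case (Suc n)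
  have "\<exists>k. L i k * matrix_power L n k j \<noteq> 0"
  proof (rule ccontr)
    assume "\<not> ?thesis"
    then have "(\<lambda>k. L i k * matrix_power L n k j) = (\<lambda>_. 0)" by auto
    then show False using Suc.prems by simp
  qed
  then obtain k where "L i k \<noteq> 0" "matrix_power L n k j \<noteq> 0" by auto
  with Suc.IH show ?case by (meson converse_rtranclp_into_rtranclp)
qed

lemma irreducible_matrix_propagate:
  assumes "irreducible_matrix L"
    and step: "\<And>a b. L a b \<noteq> 0 \<Longrightarrow> P a \<Longrightarrow> P b"
    and "P i"
  shows "P j"
proof -
  obtain n where "0 < matrix_power L n i j"
    using assms(1) unfolding irreducible_matrix_def by blast
  then have "(\<lambda>a b. L a b \<noteq> 0)\<^sup>*\<^sup>* i j"
    using matrix_power_nonzero_imp_path[of L n i j] by simp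
  then show ?thesis
    by (induction rule: rtranclp_induct) (auto intro: step \<open>P i\<close>)
qed

section \<open>Invariant measures and reversals\<close>

lemma ennreal_suminf_pos_iff:
  fixes f :: "nat \<Rightarrow> ennreal"
  shows "0 < suminf f \<longleftrightarrow> (\<exists>a. 0 < f a)"
  by (rule suminf_pos_iff) auto

lemma invariant_measure_positive:
  assumes L: "transition_matrix L" and irr: "irreducible_matrix L"
    and inv: "invariant_measure L \<eta>"
  shows "positive_measure \<eta>"
proof -
  have nonneg: "0 \<le> \<eta> a" "0 \<le> L a b" and sums: "(\<lambda>a. \<eta> a * L a b) sums \<eta> b" for a b
    using L inv unfolding transition_matrix_def invariant_measure_def by auto
  obtain i where i: "0 < \<eta> i"
    using inv unfolding invariant_measure_def ennreal_suminf_pos_iff by auto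
  have step: "0 < \<eta> b" if "L a b \<noteq> 0" "0 < \<eta> a" for a b
  proof -
    have "0 < \<eta> a * L a b" using that nonneg(2)[of a b] by simp
    also have "\<dots> = sum (\<lambda>a. \<eta> a * L a b) {a}" by simp
    also have "\<dots> \<le> \<eta> b"
      using sum_le_suminf[OF sums_summable[OF sums[of b]], of "{a}"] sums_unique[OF sums[of b]]
      by (simp add: nonneg)
    finally show ?thesis .
  qed
  show ?thesis
    unfolding positive_measure_def
    using irreducible_matrix_propagate[where P = "\<lambda>a. 0 < \<eta> a", OF irr] step i by metis
qed

definition reversal :: "nat_matrix \<Rightarrow> (nat \<Rightarrow> real) \<Rightarrow> nat_matrix" where
  "reversal L \<eta> = (\<lambda>b a. \<eta> a * L a b / \<eta> b)"

lemma balance_iff_reversal: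
  assumes "positive_measure \<eta>"
  shows "(\<forall>a b. \<eta> a * L a b = \<eta> b * U b a) \<longleftrightarrow> U = reversal L \<eta>"
proof -
  have "\<eta> b \<noteq> 0" for b
    using assms unfolding positive_measure_def by (metis less_irrefl)
  then show ?thesis by (auto simp: reversal_def fun_eq_iff field_simps)
qed

text \<open>
  The invariance equation at \<open>b\<close>, divided by \<open>\<eta> b\<close>, is the sum of row \<open>b\<close> of the reversal.
\<close>

lemma transition_matrix_reversal_iff:
  assumes L: "transition_matrix L" and pos: "positive_measure \<eta>"
  shows "transition_matrix (reversal L \<eta>) \<longleftrightarrow> invariant_measure L \<eta>"
proof -
  have \<eta>: "0 < \<eta> a" and nonneg: "0 \<le> L a b" for a b
    using L pos unfolding transition_matrix_def positive_measure_def by auto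
  have "(\<lambda>a. reversal L \<eta> b a) sums 1 \<longleftrightarrow> (\<lambda>a. \<eta> a * L a b) sums \<eta> b" for b
    using sums_divide[of "\<lambda>a. \<eta> a * L a b" "\<eta> b" "\<eta> b"]
      sums_mult[of "\<lambda>a. reversal L \<eta> b a" 1 "\<eta> b"] \<eta>[of b]
    by (auto simp: reversal_def)
  moreover have "0 \<le> reversal L \<eta> b a" for a b
    using \<eta>[of a] \<eta>[of b] nonneg by (simp add: reversal_def)
  moreover have "0 < (\<Sum>a. ennreal (\<eta> a))"
    unfolding ennreal_suminf_pos_iff using \<eta> by auto
  ultimately show ?thesis
    unfolding transition_matrix_def invariant_measure_def using \<eta> by (simp add: less_imp_le)
qed

lemma time_reversal_iff:
  assumes "transition_matrix L"
  shows "time_reversal L U \<longleftrightarrow>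
    (\<exists>\<eta>. positive_measure \<eta> \<and> invariant_measure L \<eta> \<and> U = reversal L \<eta>)"
proof -
  have "time_reversal L U \<longleftrightarrow>
      (\<exists>\<eta>. positive_measure \<eta> \<and> U = reversal L \<eta> \<and> transition_matrix U)"
    unfolding time_reversal_def using balance_iff_reversal[of _ L U] by auto
  also have "\<dots> \<longleftrightarrow> (\<exists>\<eta>. positive_measure \<eta> \<and> invariant_measure L \<eta> \<and> U = reversal L \<eta>)"
    using transition_matrix_reversal_iff[OF assms] by blast
  finally show ?thesis .
qed

lemma time_reversal_sym:
  assumes "transition_matrix L" "time_reversal L U"
  shows "time_reversal U L"
proof -
  obtain \<eta> where "positive_measure \<eta>" "\<forall>a b. \<eta> a * L a b = \<eta> b * U b a"
    using assms(2) unfolding time_reversal_def by blast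
  then have "positive_measure \<eta>" "\<forall>a b. \<eta> a * U a b = \<eta> b * L b a" by simp_all
  with assms(1) show ?thesis unfolding time_reversal_def by blast
qed

section \<open>Proportionality as the kernel of the reversal map\<close>

lemma proportional_if_same_reversal:
  assumes irr: "irreducible_matrix L"
    and pos: "positive_measure \<eta>" "positive_measure \<eta>'"
    and eq: "reversal L \<eta> = reversal L \<eta>'"
  shows "\<exists>c>0. \<forall>a. \<eta>' a = c * \<eta> a"
proof -
  have \<eta>: "0 < \<eta> a" "0 < \<eta>' a" for a
    using pos unfolding positive_measure_def by auto
  define c where "c = \<eta>' 0 / \<eta> 0"
  have step: "\<eta>' b / \<eta> b = c" if "L a b \<noteq> 0" "\<eta>' a / \<eta> a = c" for a b
  proof -
    have "\<eta> a * L a b / \<eta> b = \<eta>' a * L a b / \<eta>' b"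
      using eq unfolding reversal_def by metis
    then have "\<eta>' b / \<eta> b = \<eta>' a / \<eta> a"
      using \<open>L a b \<noteq> 0\<close> \<eta>(1)[of a] \<eta>(1)[of b] \<eta>(2)[of a] \<eta>(2)[of b]
      by (simp add: frac_eq_eq) (simp add: mult.commute)
    with that show ?thesis by simp
  qed
  have ratio: "\<eta>' a / \<eta> a = c" for a
    using irreducible_matrix_propagate[where P = "\<lambda>a. \<eta>' a / \<eta> a = c", OF irr] step c_def
    by metis
  have "\<eta>' a = c * \<eta> a" for a
    using ratio[of a] \<eta>(1)[of a] by (simp add: field_simps)
  moreover have "c > 0" using \<eta> by (simp add: c_def)
  ultimately show ?thesis by blast
qed

lemma proportional_rel_eq_kernel:
  assumes "transition_matrix L" "irreducible_matrix L"
  shows "proportional_rel L =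
    {(\<eta>, \<eta>'). invariant_measure L \<eta> \<and> invariant_measure L \<eta>' \<and> reversal L \<eta> = reversal L \<eta>'}"
proof -
  have "(\<exists>c>0. \<forall>a. \<eta>' a = c * \<eta> a) \<longleftrightarrow> reversal L \<eta> = reversal L \<eta>'"
    if "invariant_measure L \<eta>" "invariant_measure L \<eta>'" for \<eta> \<eta>'
  proof
    assume "\<exists>c>0. \<forall>a. \<eta>' a = c * \<eta> a"
    then show "reversal L \<eta> = reversal L \<eta>'" by (auto simp: reversal_def)
  next
    assume "reversal L \<eta> = reversal L \<eta>'"
    then show "\<exists>c>0. \<forall>a. \<eta>' a = c * \<eta> a"
      using proportional_if_same_reversal assms that invariant_measure_positive by metis
  qed
  then show ?thesis
    unfolding proportional_rel_def by (intro Collect_cong) (auto simp: split_beta)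
qed

text \<open>
  The map induced by \<open>f\<close> on the classes of its kernel: \<open>f\<close> takes a single value on each class, which
  \<open>the_elem\<close> extracts from the image.
\<close>

lemma
  fixes f :: "'a \<Rightarrow> 'b"
  assumes r: "r = {(x, y). x \<in> A \<and> y \<in> A \<and> f x = f y}"
  shows the_elem_image_kernel_class: "x \<in> A \<Longrightarrow> the_elem (f ` (r `` {x})) = f x"
    and bij_betw_kernel_quotient: "bij_betw (\<lambda>C. the_elem (f ` C)) (A // r) (f ` A)"
proof -
  have on_class: "the_elem (f ` (r `` {x})) = f x" if "x \<in> A" for x
  proof -
    have "f ` (r `` {x}) = {f x}" using that unfolding r by auto
    then show ?thesis by simp
  qed
  then show "x \<in> A \<Longrightarrow> the_elem (f ` (r `` {x})) = f x" .
  have "inj_on (\<lambda>C. the_elem (f ` C)) (A // r)"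
  proof (rule inj_onI)
    fix C D
    assume "C \<in> A // r" "D \<in> A // r" and eq: "the_elem (f ` C) = the_elem (f ` D)"
    then obtain x y where x: "x \<in> A" "C = r `` {x}" and y: "y \<in> A" "D = r `` {y}"
      by (metis quotientE)
    with eq have "f x = f y" using on_class by metis
    with x y show "C = D" unfolding r by auto
  qed
  moreover have "(\<lambda>C. the_elem (f ` C)) ` (A // r) = f ` A"
    unfolding quotient_def image_UN using on_class by auto
  ultimately show "bij_betw (\<lambda>C. the_elem (f ` C)) (A // r) (f ` A)"
    unfolding bij_betw_def by blast
qed

section \<open>Time-reversals and invariant measures\<close>

theorem theorem3p2:
  fixes L :: "nat \<Rightarrow> nat \<Rightarrow> real"
  assumes "transition_matrix L"
    and "irreducible_matrix L"
    and "almost_lower_triangular L"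
  shows "((\<exists>U. time_reversal L U) \<longleftrightarrow>
            (\<exists>\<eta>. positive_measure \<eta> \<and> invariant_measure L \<eta>))
       \<and> (\<forall>U. time_reversal L U \<longrightarrow>
            time_reversal U L \<and>
            (\<exists>\<eta>. positive_measure \<eta> \<and> invariant_measure L \<eta> \<and>
                 (\<forall>a b. U b a = \<eta> a * L a b / \<eta> b)))
       \<and> (\<forall>\<eta> U. positive_measure \<eta> \<and> invariant_measure L \<eta> \<and>
            (\<forall>a b. U b a = \<eta> a * L a b / \<eta> b) \<longrightarrow>
            time_reversal L U \<and> time_reversal U L)
       \<and> (\<exists>\<Phi>. bij_betw \<Phi> (invariant_classes L) {U. time_reversal L U} \<and>
            (\<forall>\<eta>. invariant_measure L \<eta> \<longrightarrow>
               (\<forall>a b. \<Phi> (proportional_rel L `` {\<eta>}) b a = \<eta> a * L a b / \<eta> b)))"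
proof (intro conjI)
  note L = assms(1) and irr = assms(2)
  note tr_iff = time_reversal_iff[OF L]
  have entries: "(\<forall>a b. U b a = \<eta> a * L a b / \<eta> b) \<longleftrightarrow> U = reversal L \<eta>" for U \<eta>
    by (auto simp: reversal_def fun_eq_iff)
  show "(\<exists>U. time_reversal L U) \<longleftrightarrow> (\<exists>\<eta>. positive_measure \<eta> \<and> invariant_measure L \<eta>)"
    using tr_iff by blast
  show "\<forall>U. time_reversal L U \<longrightarrow> time_reversal U L \<and>
      (\<exists>\<eta>. positive_measure \<eta> \<and> invariant_measure L \<eta> \<and>
        (\<forall>a b. U b a = \<eta> a * L a b / \<eta> b))"
    unfolding entries using tr_iff time_reversal_sym[OF L] by blast
  show "\<forall>\<eta> U. positive_measure \<eta> \<and> invariant_measure L \<eta> \<and>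
      (\<forall>a b. U b a = \<eta> a * L a b / \<eta> b) \<longrightarrow> time_reversal L U \<and> time_reversal U L"
    unfolding entries using tr_iff time_reversal_sym[OF L] by blast
  let ?A = "{\<eta>. invariant_measure L \<eta>}"
  let ?\<Phi> = "\<lambda>C. the_elem (reversal L ` C)"
  have kernel: "proportional_rel L =
      {(\<eta>, \<eta>'). \<eta> \<in> ?A \<and> \<eta>' \<in> ?A \<and> reversal L \<eta> = reversal L \<eta>'}"
    using proportional_rel_eq_kernel[OF L irr] by simp
  have image: "reversal L ` ?A = {U. time_reversal L U}"
    using tr_iff invariant_measure_positive[OF L irr] by blast
  have "bij_betw ?\<Phi> (invariant_classes L) {U. time_reversal L U}"
    using bij_betw_kernel_quotient[OF kernel] unfolding invariant_classes_def image .
  moreover have "?\<Phi> (proportional_rel L `` {\<eta>}) b a = \<eta> a * L a b / \<eta> b"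
    if "invariant_measure L \<eta>" for \<eta> a b
    using the_elem_image_kernel_class[OF kernel, of \<eta>] that by (simp add: reversal_def)
  ultimately show "\<exists>\<Phi>. bij_betw \<Phi> (invariant_classes L) {U. time_reversal L U} \<and>
      (\<forall>\<eta>. invariant_measure L \<eta> \<longrightarrow>
        (\<forall>a b. \<Phi> (proportional_rel L `` {\<eta>}) b a = \<eta> a * L a b / \<eta> b))"
    by blast
qed

end
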